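(* Let $0<\theta<1$ and let $\hat{A}:\Omega\times\Omega\to\mathbb{R}$ be Lipschitz with respect to $\hat d_\theta$. Fix $z\in\Omega$ and put $$W_n(x,y)=\sum_{k\ge0}\Big(\hat A(\hat\Phi_n^k(x,y))-\hat A(\hat\Phi_n^k(x,z))\Big).$$ Then $W_n:\Omega\times\Omega\to\mathbb{R}$ is well defined, and there exists a function $B:\Omega\to\mathbb{R}$, Lipschitz with respect to $d_{\sqrt\theta}$, such that for all $x,y\in\Omega$ $$\hat A(x,y)=B(x)+W_n(x,y)-W_n(\hat\Phi_n(x,y)).$$ Consequently, the $\hat\Phi_n$-equilibrium probabilities for $\hat A$ and for the potential $(x,y)\mapsto B(x)$ are the same.
   Context: $\mathcal{A}=\{1,\dots,r\}$, $\Omega=\mathcal{A}^{\mathbb{N}}$. For $0<\theta<1$, $d_\theta(x,x')=\theta^N$ where $N\ge1$ is the first index with $x_N\ne x'_N$ (and $0$ if $x=x'$), and $\hat d_\theta((x,y),(x',y'))=\max(d_\theta(x,x'),d_\theta(y,y'))$ on $\Omega\times\Omega$. Let $\phi:\mathcal{A}\times\mathcal{A}\to\mathcal{A}$ be such that $b\mapsto\phi(a,b)$ is bijective for every fixed $a$, and $\Phi(x_1,x_2,x_3,\dots)=(\phi(x_1,x_2),\phi(x_2,x_3),\dots)$. For $j\in\mathcal{A}$, $\tau_j(x)$ is the unique $y\in\Omega$ with $\Phi(y)=x$, $y_1=j$. The non-mixed skew product is $\hat\Phi_n:\Omega\times\Omega\to\Omega\times\Omega$, $\hat\Phi_n(x,y)=(\Phi(x),\tau_{x_1}(y))$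 (the subscript $n$ is only a name, for "non-mixed"; $\hat\Phi_n^k$ is the $k$-th iterate). For a continuous $\hat C:\Omega\times\Omega\to\mathbb{R}$, a $\hat\Phi_n$-equilibrium probability for $\hat C$ is a $\hat\Phi_n$-invariant Borel probability $\hat\mu$ attaining $\sup\{h(\hat\mu)+\int\hat C\,d\hat\mu\}$ over $\hat\Phi_n$-invariant Borel probabilities, with $h$ the Kolmogorov–Sinai entropy. *)

theory Defs
  imports "HOL-Probability.Probability"
begin

text \<open>A sequence \<open>(x\<^sub>1, x\<^sub>2, \<dots>)\<close> over the alphabet \<open>{1..r}\<close> is a function \<open>x :: nat \<Rightarrow> nat\<close>
  with indices shifted by one: \<open>x i\<close> stands for \<open>x\<^bsub>i+1\<^esub>\<close>; so \<open>x 0\<close> is the first symbol.\<close>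

definition Omega :: "nat \<Rightarrow> (nat \<Rightarrow> nat) set" where
  "Omega r = {x. \<forall>i. x i \<in> {1..r}}"

text \<open>The exponent is \<open>N \<ge> 1\<close>, the first disagreement index counted from 1; hence the \<open>Suc\<close>.\<close>

definition d_seq :: "real \<Rightarrow> (nat \<Rightarrow> nat) \<Rightarrow> (nat \<Rightarrow> nat) \<Rightarrow> real" where
  "d_seq \<theta> x x' = (if x = x' then 0 else \<theta> ^ Suc (LEAST i. x i \<noteq> x' i))"

definition d_hat :: "real \<Rightarrow> (nat \<Rightarrow> nat) \<times> (nat \<Rightarrow> nat) \<Rightarrow> (nat \<Rightarrow> nat) \<times> (nat \<Rightarrow> nat) \<Rightarrow> real" where
  "d_hat \<theta> p q = max (d_seq \<theta> (fst p) (fst q)) (d_seq \<theta> (snd p) (snd q))"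

text \<open>The library's \<open>lipschitz_on\<close> is tied to the type class metric, so the metric is a
  parameter here.\<close>

definition lipschitz_wrt :: "('b \<Rightarrow> 'b \<Rightarrow> real) \<Rightarrow> 'b set \<Rightarrow> ('b \<Rightarrow> real) \<Rightarrow> bool" where
  "lipschitz_wrt d S f \<longleftrightarrow> (\<exists>K\<ge>0. \<forall>p\<in>S. \<forall>q\<in>S. \<bar>f p - f q\<bar> \<le> K * d p q)"

definition Phi :: "(nat \<Rightarrow> nat \<Rightarrow> nat) \<Rightarrow> (nat \<Rightarrow> nat) \<Rightarrow> (nat \<Rightarrow> nat)" where
  "Phi \<phi> x = (\<lambda>i. \<phi> (x i) (x (Suc i)))"

definition tau :: "nat \<Rightarrow> (nat \<Rightarrow> nat \<Rightarrow> nat) \<Rightarrow> nat \<Rightarrow> (nat \<Rightarrow> nat) \<Rightarrow> (nat \<Rightarrow> nat)" where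
  "tau r \<phi> j x = (THE y. y \<in> Omega r \<and> Phi \<phi> y = x \<and> y 0 = j)"

definition Phi_n :: "nat \<Rightarrow> (nat \<Rightarrow> nat \<Rightarrow> nat) \<Rightarrow>
    (nat \<Rightarrow> nat) \<times> (nat \<Rightarrow> nat) \<Rightarrow> (nat \<Rightarrow> nat) \<times> (nat \<Rightarrow> nat)" where
  "Phi_n r \<phi> = (\<lambda>(x, y). (Phi \<phi> x, tau r \<phi> (x 0) y))"

definition W_term :: "nat \<Rightarrow> (nat \<Rightarrow> nat \<Rightarrow> nat) \<Rightarrow> ((nat \<Rightarrow> nat) \<times> (nat \<Rightarrow> nat) \<Rightarrow> real) \<Rightarrow>
    (nat \<Rightarrow> nat) \<Rightarrow> (nat \<Rightarrow> nat) \<times> (nat \<Rightarrow> nat) \<Rightarrow> nat \<Rightarrow> real" where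
  "W_term r \<phi> A z = (\<lambda>(x, y) k. A ((Phi_n r \<phi> ^^ k) (x, y)) - A ((Phi_n r \<phi> ^^ k) (x, z)))"

definition W_n :: "nat \<Rightarrow> (nat \<Rightarrow> nat \<Rightarrow> nat) \<Rightarrow> ((nat \<Rightarrow> nat) \<times> (nat \<Rightarrow> nat) \<Rightarrow> real) \<Rightarrow>
    (nat \<Rightarrow> nat) \<Rightarrow> (nat \<Rightarrow> nat) \<times> (nat \<Rightarrow> nat) \<Rightarrow> real" where
  "W_n r \<phi> A z p = (\<Sum>k. W_term r \<phi> A z p k)"

subsection \<open>Kolmogorov--Sinai entropy\<close>

definition partition_entropy :: "'b measure \<Rightarrow> 'b set set \<Rightarrow> real" where
  "partition_entropy M P = - (\<Sum>a\<in>P. measure M a * ln (measure M a))"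

text \<open>The join of the partitions \<open>T\<^sup>-\<^sup>k P\<close> for \<open>k < n\<close>; empty intersections are dropped.\<close>

definition iterated_join :: "'b measure \<Rightarrow> ('b \<Rightarrow> 'b) \<Rightarrow> 'b set set \<Rightarrow> nat \<Rightarrow> 'b set set" where
  "iterated_join M T P n =
     (\<lambda>a. {x \<in> space M. \<forall>k<n. (T ^^ k) x \<in> a k}) ` ({..<n} \<rightarrow>\<^sub>E P) - {{}}"

definition entropy_wrt_partition :: "'b measure \<Rightarrow> ('b \<Rightarrow> 'b) \<Rightarrow> 'b set set \<Rightarrow> real" where
  "entropy_wrt_partition M T P =
     lim (\<lambda>n. partition_entropy M (iterated_join M T P n) / real n)"

definition KS_entropy :: "'b measure \<Rightarrow> ('b \<Rightarrow> 'b) \<Rightarrow> ereal" where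
  "KS_entropy M T =
     (SUP P\<in>{P. finite P \<and> P \<subseteq> sets M \<and> partition_on (space M) P}.
        ereal (entropy_wrt_partition M T P))"

subsection \<open>Equilibrium probabilities\<close>

text \<open>The type class topology on \<open>nat \<Rightarrow> nat\<close> is the product of discrete topologies. On
  \<open>Omega r\<close> it is the topology of \<open>d_seq \<theta>\<close> for every \<open>0 < \<theta> < 1\<close>, so \<open>restrict_space borel\<close>
  below yields the Borel sets of the metric space.\<close>

definition invariant_probs :: "'b::topological_space set \<Rightarrow> ('b \<Rightarrow> 'b) \<Rightarrow> 'b measure set" where
  "invariant_probs X T = {\<mu>. prob_space \<mu> \<and> sets \<mu> = sets (restrict_space borel X) \<and>
     T \<in> measurable \<mu> \<mu> \<and> distr \<mu> \<mu> T = \<mu>}"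

definition equilibrium_prob ::
    "'b::topological_space set \<Rightarrow> ('b \<Rightarrow> 'b) \<Rightarrow> ('b \<Rightarrow> real) \<Rightarrow> 'b measure \<Rightarrow> bool" where
  "equilibrium_prob X T C \<mu> \<longleftrightarrow> \<mu> \<in> invariant_probs X T \<and>
     KS_entropy \<mu> T + ereal (\<integral>p. C p \<partial>\<mu>) =
       (SUP \<nu>\<in>invariant_probs X T. KS_entropy \<nu> T + ereal (\<integral>p. C p \<partial>\<nu>))"

end

(* Since \<open>tau\<close> contracts, the second coordinates of the orbits of \<open>(x, y)\<close> and \<open>(x, z)\<close> merge
   exponentially fast while the first coordinates coincide, so the series \<open>W\<^sub>n\<close> converges
   geometrically. Rearranging it gives \<open>A - W\<^sub>n + W\<^sub>n \<circ> \<Phi>\<^sub>n = A(x, z) + W\<^sub>n(\<Phi>\<^sub>n(x, z))\<close>, which is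
   independent of \<open>y\<close>. If \<open>x\<close> and \<open>x'\<close> share \<open>N\<close> symbols, the \<open>k\<close>-th terms of the two series differ by
   \<open>O(min(\<theta>\<^sup>k, \<theta>\<^bsup>N-k\<^esup>))\<close>; splitting at \<open>k = N/2\<close> gives \<open>O(\<theta>\<^bsup>N/2\<^esup>)\<close>, whence the exponent \<open>sqrt \<theta>\<close>.
   Finally \<open>A\<close> and \<open>B\<close> are cohomologous, so they have the same integral against every invariant
   probability. *)
theory Submission imports Defs begin

section \<open>Common prefixes as a measure of distance\<close>

definition agree :: "nat \<Rightarrow> (nat \<Rightarrow> 'a) \<Rightarrow> (nat \<Rightarrow> 'a) \<Rightarrow> bool" where
  "agree n x y \<longleftrightarrow> (\<forall>i<n. x i = y i)"

lemma agree_0 [simp]: "agree 0 x y"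
  by (simp add: agree_def)

lemma agree_refl [simp]: "agree n x x"
  by (simp add: agree_def)

lemma agree_mono: "agree n x y \<Longrightarrow> m \<le> n \<Longrightarrow> agree m x y"
  by (simp add: agree_def)

text \<open>The first disagreement has 0-based index at least \<open>n\<close>, so the exponent in
  \<open>d_seq\<close> is even at least \<open>Suc n\<close>; one factor is given up here, at the
  cost of constants only.\<close>

lemma d_seq_le:
  assumes "agree n x y" "0 < \<theta>" "\<theta> < 1"
  shows "d_seq \<theta> x y \<le> \<theta> ^ n"
proof (cases "x = y")
  case False
  then have "\<exists>i. x i \<noteq> y i" by auto
  then have "x (LEAST i. x i \<noteq> y i) \<noteq> y (LEAST i. x i \<noteq> y i)" by (rule LeastI_ex)
  then have "n \<le> Suc (LEAST i. x i \<noteq> y i)"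
    using assms(1) unfolding agree_def by (meson le_SucI not_le_imp_less)
  then show ?thesis
    using False assms by (simp only: d_seq_def if_False) (intro power_decreasing, auto)
qed (use assms in \<open>simp add: d_seq_def\<close>)

lemma d_seq_eq:
  assumes "x \<noteq> y"
  obtains n where "agree n x y" "d_seq \<theta> x y = \<theta> ^ Suc n"
proof
  show "agree (LEAST i. x i \<noteq> y i) x y"
    unfolding agree_def using not_less_Least by blast
qed (use assms in \<open>simp add: d_seq_def\<close>)

section \<open>Orbits of the skew product\<close>

lemma agree_Phi: "agree (Suc n) x y \<Longrightarrow> agree n (Phi \<phi> x) (Phi \<phi> y)"
  by (simp add: agree_def Phi_def)

lemma agree_Phi_funpow:
  "agree (n + k) x y \<Longrightarrow> agree n ((Phi \<phi> ^^ k) x) ((Phi \<phi> ^^ k) y)"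
proof (induction k arbitrary: n)
  case (Suc k)
  then have "agree (Suc n) ((Phi \<phi> ^^ k) x) ((Phi \<phi> ^^ k) y)" by (intro Suc.IH) simp
  then show ?case by (simp add: agree_Phi)
qed simp

lemma fst_Phi_n_funpow: "fst ((Phi_n r \<phi> ^^ k) p) = (Phi \<phi> ^^ k) (fst p)"
  by (induction k) (auto simp: Phi_n_def split: prod.split)

lemma snd_Phi_n_Suc:
  "snd ((Phi_n r \<phi> ^^ Suc k) p) = tau r \<phi> ((Phi \<phi> ^^ k) (fst p) 0) (snd ((Phi_n r \<phi> ^^ k) p))"
  using fst_Phi_n_funpow[of k r \<phi> p, symmetric] by (simp add: Phi_n_def case_prod_unfold)

text \<open>The fibre is driven only by the first symbols of \<open>(Phi \<phi> ^^ i) x\<close> for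
  \<open>i < k\<close>, and these are functions of the first \<open>k\<close> symbols of
  \<open>x\<close>. Hence exact equality, not mere closeness.\<close>

lemma snd_Phi_n_cong:
  assumes "agree k x x'"
  shows "snd ((Phi_n r \<phi> ^^ k) (x, y)) = snd ((Phi_n r \<phi> ^^ k) (x', y))"
  using assms
proof (induction k)
  case (Suc k)
  have "agree 1 ((Phi \<phi> ^^ k) x) ((Phi \<phi> ^^ k) x')"
    using Suc.prems by (intro agree_Phi_funpow) simp
  then have "(Phi \<phi> ^^ k) x 0 = (Phi \<phi> ^^ k) x' 0" by (simp add: agree_def)
  moreover have "snd ((Phi_n r \<phi> ^^ k) (x, y)) = snd ((Phi_n r \<phi> ^^ k) (x', y))"
    using Suc.prems by (intro Suc.IH) (auto elim: agree_mono)
  ultimately show ?case by (simp only: snd_Phi_n_Suc fst_conv)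
qed simp

section \<open>Inverse branches of \<open>Phi\<close>\<close>

locale left_permutive =
  fixes r :: nat and \<phi> :: "nat \<Rightarrow> nat \<Rightarrow> nat"
  assumes bij: "\<forall>a\<in>{1..r}. bij_betw (\<phi> a) {1..r} {1..r}"
begin

abbreviation "X \<equiv> Omega r \<times> Omega r"
abbreviation "F \<equiv> Phi_n r \<phi>"

lemma Phi_Omega: "x \<in> Omega r \<Longrightarrow> Phi \<phi> x \<in> Omega r"
  unfolding Omega_def Phi_def using bij bij_betwE by blast

text \<open>Injectivity of \<open>\<phi> (u i)\<close> recovers \<open>u (Suc i)\<close> from
  \<open>u i\<close> and \<open>Phi \<phi> u i\<close>, so agreement spreads from the first symbol.
  This yields both uniqueness of preimages and contraction of \<open>tau\<close>.\<close>

lemma agree_preimages: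
  assumes "u \<in> Omega r" "v \<in> Omega r" "u 0 = v 0" "agree n (Phi \<phi> u) (Phi \<phi> v)"
  shows "agree (Suc n) u v"
proof -
  have "i \<le> n \<Longrightarrow> u i = v i" for i
  proof (induction i)
    case (Suc i)
    then have "Phi \<phi> u i = Phi \<phi> v i" and "u i = v i"
      using assms(4) by (simp_all add: agree_def)
    then have "\<phi> (u i) (u (Suc i)) = \<phi> (u i) (v (Suc i))" by (simp add: Phi_def)
    moreover have "inj_on (\<phi> (u i)) {1..r}" and "u (Suc i) \<in> {1..r}" and "v (Suc i) \<in> {1..r}"
      using bij assms(1,2) by (auto simp: Omega_def bij_betw_def)
    ultimately show ?case by (meson inj_onD)
  qed (simp add: assms(3))
  then show ?thesis by (simp add: agree_def)
qed

lemma preimage_exists: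
  assumes "j \<in> {1..r}" "x \<in> Omega r"
  shows "\<exists>y. y \<in> Omega r \<and> Phi \<phi> y = x \<and> y 0 = j"
proof -
  \<comment> \<open>Solve for one symbol at a time: given the current symbol \<open>a\<close>, the
    next one is the solution \<open>b\<close> of \<open>\<phi> a b = x i\<close>.\<close>
  define y where "y = rec_nat j (\<lambda>i a. inv_into {1..r} (\<phi> a) (x i))"
  have surj: "\<phi> a ` {1..r} = {1..r}" if "a \<in> {1..r}" for a
    using bij that by (auto simp: bij_betw_def)
  have x: "x i \<in> {1..r}" for i using assms(2) by (auto simp: Omega_def)
  have y: "y i \<in> {1..r}" for i
  proof (induction i)
    case (Suc i)
    have "y (Suc i) = inv_into {1..r} (\<phi> (y i)) (x i)" by (simp add: y_def)
    then show ?case using inv_into_into[of "x i" "\<phi> (y i)" "{1..r}"] surj[OF Suc] x by simp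
  qed (use assms(1) in \<open>simp add: y_def\<close>)
  have "\<phi> (y i) (y (Suc i)) = x i" for i
    using f_inv_into_f[of "x i" "\<phi> (y i)" "{1..r}"] surj[OF y] x by (simp add: y_def)
  then have "y \<in> Omega r \<and> Phi \<phi> y = x \<and> y 0 = j"
    using y by (auto simp: Omega_def Phi_def y_def)
  then show ?thesis by blast
qed

lemma tau_props:
  assumes "j \<in> {1..r}" "x \<in> Omega r"
  shows "tau r \<phi> j x \<in> Omega r \<and> Phi \<phi> (tau r \<phi> j x) = x \<and> tau r \<phi> j x 0 = j"
  unfolding tau_def
proof (rule theI'[where P = "\<lambda>y. y \<in> Omega r \<and> Phi \<phi> y = x \<and> y 0 = j"],
    rule ex_ex1I[OF preimage_exists[OF assms]])
  fix u v
  assume u: "u \<in> Omega r \<and> Phi \<phi> u = x \<and> u 0 = j" and v: "v \<in> Omega r \<and> Phi \<phi> v = x \<and> v 0 = j"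
  have "agree (Suc n) u v" for n
    by (rule agree_preimages) (use u v in auto)
  then show "u = v" by (auto simp: agree_def)
qed

lemma agree_tau:
  assumes "j \<in> {1..r}" "x \<in> Omega r" "y \<in> Omega r" "agree n x y"
  shows "agree (Suc n) (tau r \<phi> j x) (tau r \<phi> j y)"
  using assms tau_props[of j x] tau_props[of j y] by (intro agree_preimages) auto

lemma Phi_n_in: "p \<in> X \<Longrightarrow> F p \<in> X"
  using Phi_Omega tau_props by (auto simp: Phi_n_def Omega_def split: prod.split)

lemma Phi_n_funpow_in: "p \<in> X \<Longrightarrow> (F ^^ k) p \<in> X"
  by (induction k) (auto intro: Phi_n_in simp del: mem_Sigma_iff)

text \<open>Both orbits lie over the same \<open>x\<close>, so the same inverse branch acts on both
  fibres at each step, and each branch adds one common symbol.\<close>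

lemma agree_snd_Phi_n:
  assumes "x \<in> Omega r" "y \<in> Omega r" "y' \<in> Omega r"
  shows "agree k (snd ((F ^^ k) (x, y))) (snd ((F ^^ k) (x, y')))"
proof (induction k)
  case (Suc k)
  have "(F ^^ k) (x, y) \<in> X" "(F ^^ k) (x, y') \<in> X"
    using assms by (auto intro!: Phi_n_funpow_in simp del: mem_Sigma_iff)
  moreover from this(1) have "(Phi \<phi> ^^ k) x 0 \<in> {1..r}"
    using fst_Phi_n_funpow[of k r \<phi> "(x, y)"] unfolding mem_Times_iff by (auto simp: Omega_def)
  ultimately show ?case
    unfolding snd_Phi_n_Suc fst_conv mem_Times_iff using Suc by (intro agree_tau) auto
qed simp

end

section \<open>Convergence of the series \<open>W_n\<close>\<close>

locale lipschitz_potential = left_permutive +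
  fixes \<theta> K :: real and A :: "(nat \<Rightarrow> nat) \<times> (nat \<Rightarrow> nat) \<Rightarrow> real" and z :: "nat \<Rightarrow> nat"
  assumes theta: "0 < \<theta>" "\<theta> < 1" and K: "0 \<le> K"
    and lip: "p \<in> X \<Longrightarrow> q \<in> X \<Longrightarrow> \<bar>A p - A q\<bar> \<le> K * d_hat \<theta> p q"
    and z: "z \<in> Omega r"
begin

abbreviation "W \<equiv> W_n r \<phi> A z"
abbreviation "Wt \<equiv> W_term r \<phi> A z"

lemma A_diff_le:
  assumes "p \<in> X" "q \<in> X" "agree n (fst p) (fst q)" "agree n (snd p) (snd q)"
  shows "\<bar>A p - A q\<bar> \<le> K * \<theta> ^ n"
proof -
  have "d_hat \<theta> p q \<le> \<theta> ^ n" using assms theta by (simp add: d_hat_def d_seq_le)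
  then show ?thesis using lip[OF assms(1,2)] K by (meson mult_left_mono order_trans)
qed

lemma W_term_le:
  assumes "p \<in> X"
  shows "\<bar>Wt p k\<bar> \<le> K * \<theta> ^ k"
proof -
  obtain x y where p: "p = (x, y)" "x \<in> Omega r" "y \<in> Omega r" using assms by auto
  have "\<bar>A ((F ^^ k) (x, y)) - A ((F ^^ k) (x, z))\<bar> \<le> K * \<theta> ^ k"
    using p(2,3) z
    by (intro A_diff_le Phi_n_funpow_in agree_snd_Phi_n) (auto simp: fst_Phi_n_funpow)
  then show ?thesis by (simp add: W_term_def p)
qed

lemma summable_W_term:
  assumes "p \<in> X"
  shows "summable (Wt p)"
proof (rule summable_comparison_test')
  show "summable (\<lambda>k. K * \<theta> ^ k)" using theta by (intro summable_mult) auto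
  show "norm (Wt p k) \<le> K * \<theta> ^ k" if "0 \<le> k" for k using W_term_le[OF assms] by simp
qed

lemma geometric_suminf_le:
  fixes f :: "nat \<Rightarrow> real"
  assumes "\<And>k. \<bar>f k\<bar> \<le> C * s ^ k" "0 < s" "s < 1"
  shows "\<bar>suminf f\<bar> \<le> C / (1 - s)"
proof -
  have "summable (\<lambda>k. C * s ^ k)" using assms by (intro summable_mult) auto
  then have "norm (suminf f) \<le> (\<Sum>k. C * s ^ k)"
    using assms(1) by (intro norm_suminf_le) auto
  then show ?thesis
    using assms(2,3) by (simp add: suminf_mult suminf_geometric divide_inverse)
qed

lemma W_le: "p \<in> X \<Longrightarrow> \<bar>W p\<bar> \<le> K / (1 - \<theta>)"
  unfolding W_n_def by (rule geometric_suminf_le[OF W_term_le theta])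

section \<open>Regularity of \<open>W_n\<close> in the first coordinate\<close>

lemma W_term_diff_le:
  assumes "x \<in> Omega r" "x' \<in> Omega r" "y \<in> Omega r" "agree N x x'" "k \<le> N"
  shows "\<bar>Wt (x, y) k - Wt (x', y) k\<bar> \<le> 2 * K * \<theta> ^ (N - k)"
proof -
  \<comment> \<open>Up to time \<open>N\<close> the fibre coordinates over \<open>x\<close> and
    \<open>x'\<close> are equal, so only the base differs, with \<open>N - k\<close> symbols still
    shared. Taking \<open>v = y\<close> and \<open>v = z\<close> gives the factor 2.\<close>
  have *: "\<bar>A ((F ^^ k) (x, v)) - A ((F ^^ k) (x', v))\<bar> \<le> K * \<theta> ^ (N - k)"
    if "v \<in> Omega r" for v
  proof (intro A_diff_le Phi_n_funpow_in)
    show "agree (N - k) (fst ((F ^^ k) (x, v))) (fst ((F ^^ k) (x', v)))"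
      using assms(4,5) by (simp add: fst_Phi_n_funpow agree_Phi_funpow)
    show "agree (N - k) (snd ((F ^^ k) (x, v))) (snd ((F ^^ k) (x', v)))"
      using snd_Phi_n_cong[OF agree_mono[OF assms(4,5)], of r \<phi> v] by simp
  qed (use that assms in auto)
  show ?thesis using *[OF assms(3)] *[OF z] by (simp add: W_term_def)
qed

text \<open>The two summands bound the head (ratio \<open>sqrt \<theta>\<close>) and the tail (ratio
  \<open>\<theta>\<close>) of the split series in \<open>W_diff_le\<close>.\<close>

definition Lw :: real where
  "Lw = 2 * K * (1 / (1 - sqrt \<theta>) + 1 / (1 - \<theta>))"

lemma Lw_nonneg: "0 \<le> Lw"
  using K theta by (simp add: Lw_def)

lemma W_diff_le:
  assumes "x \<in> Omega r" "x' \<in> Omega r" "y \<in> Omega r" "agree N x x'"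
  shows "\<bar>W (x, y) - W (x', y)\<bar> \<le> Lw * sqrt \<theta> ^ N"
proof -
  define s where "s = sqrt \<theta>"
  have s: "0 < s" "s < 1" and s2: "\<theta> = s ^ 2" using theta by (auto simp: s_def)
  define f where "f k = Wt (x, y) k - Wt (x', y) k" for k
  \<comment> \<open>Half of \<open>N\<close>, rounded up: \<open>2 * m \<ge> N\<close> turns
    \<open>\<theta> ^ m\<close> into at most \<open>s ^ N\<close> in the tail, while
    \<open>k < m\<close> still ensures \<open>k \<le> N\<close> in the head.\<close>
  define m where "m = (N + 1) div 2"
  have X: "(x, y) \<in> X" "(x', y) \<in> X" using assms by auto
  have sf: "summable f"
    unfolding f_def using X by (intro summable_diff summable_W_term)
  have eq: "W (x, y) - W (x', y) = suminf f"
    unfolding W_n_def f_def using X by (intro suminf_diff summable_W_term)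
  \<comment> \<open>The surplus \<open>s ^ (m - Suc k)\<close> is kept because bounding every term
    by \<open>s ^ N\<close> alone would leave a factor \<open>m\<close> growing with
    \<open>N\<close>.\<close>
  have head: "\<bar>f k\<bar> \<le> 2 * K * s ^ N * s ^ (m - Suc k)" if "k < m" for k
  proof -
    have kN: "k \<le> N" "N + (m - Suc k) \<le> 2 * (N - k)" using that by (auto simp: m_def)
    have "\<theta> ^ (N - k) = s ^ (2 * (N - k))" by (simp add: s2 power_mult)
    also have "\<dots> \<le> s ^ (N + (m - Suc k))" using s kN by (intro power_decreasing) auto
    finally have "\<theta> ^ (N - k) \<le> s ^ N * s ^ (m - Suc k)" by (simp add: power_add)
    then have "2 * K * \<theta> ^ (N - k) \<le> 2 * K * (s ^ N * s ^ (m - Suc k))"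
      using K by (intro mult_left_mono) auto
    then show ?thesis using W_term_diff_le[OF assms kN(1)] by (simp add: f_def mult.assoc)
  qed
  have tail: "\<bar>f (k + m)\<bar> \<le> 2 * K * s ^ N * \<theta> ^ k" for k
  proof -
    have "\<theta> ^ m = s ^ (2 * m)" by (simp add: s2 power_mult)
    also have "\<dots> \<le> s ^ N" using s by (intro power_decreasing) (auto simp: m_def)
    finally have "2 * K * (\<theta> ^ k * \<theta> ^ m) \<le> 2 * K * (\<theta> ^ k * s ^ N)"
      using K theta by (intro mult_left_mono) auto
    moreover have "\<bar>f (k + m)\<bar> \<le> 2 * K * \<theta> ^ (k + m)"
      using W_term_le[OF X(1), of "k + m"] W_term_le[OF X(2), of "k + m"] by (simp add: f_def)
    ultimately show ?thesis by (simp add: power_add mult_ac)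
  qed
  have "(\<Sum>k<m. s ^ (m - Suc k)) = (\<Sum>k<m. s ^ k)" by (rule sum.nat_diff_reindex)
  also have "\<dots> \<le> 1 / (1 - s)"
    using sum_le_suminf[of "\<lambda>k. s ^ k" "{..<m}"] s by (simp add: suminf_geometric)
  finally have geo: "(\<Sum>k<m. s ^ (m - Suc k)) \<le> 1 / (1 - s)" .
  have "\<bar>\<Sum>k<m. f k\<bar> \<le> (\<Sum>k<m. 2 * K * s ^ N * s ^ (m - Suc k))"
    by (rule order_trans[OF sum_abs]) (use head in \<open>auto intro: sum_mono\<close>)
  also have "\<dots> \<le> 2 * K * s ^ N * (1 / (1 - s))"
    unfolding sum_distrib_left[symmetric] using geo K s by (intro mult_left_mono) auto
  finally have "\<bar>\<Sum>k<m. f k\<bar> \<le> 2 * K * s ^ N * (1 / (1 - s))" .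
  moreover have "\<bar>\<Sum>k. f (k + m)\<bar> \<le> 2 * K * s ^ N / (1 - \<theta>)"
    using tail theta by (intro geometric_suminf_le) auto
  moreover have "suminf f = (\<Sum>k. f (k + m)) + (\<Sum>k<m. f k)"
    by (rule suminf_split_initial_segment[OF sf])
  ultimately have "\<bar>suminf f\<bar> \<le> 2 * K * s ^ N / (1 - \<theta>) + 2 * K * s ^ N * (1 / (1 - s))"
    by linarith
  also have "\<dots> = Lw * s ^ N" by (simp add: Lw_def s_def algebra_simps)
  finally show ?thesis by (simp add: eq s_def)
qed

section \<open>The function \<open>B\<close> and the cohomological equation\<close>

definition B :: "(nat \<Rightarrow> nat) \<Rightarrow> real" where
  "B x = A (x, z) + W (F (x, z))"

text \<open>The formula for \<open>B\<close> is forced: at \<open>y = z\<close> every term of the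
  series for \<open>W (x, z)\<close> is 0, and the equation reduces to the definition of
  \<open>B\<close>.\<close>

lemma cohomology:
  assumes "x \<in> Omega r" "y \<in> Omega r"
  shows "A (x, y) = B x + W (x, y) - W (F (x, y))"
proof -
  have X: "(x, y) \<in> X" "F (x, y) \<in> X" "F (x, z) \<in> X" using assms z by (auto intro!: Phi_n_in)
  have "W (x, y) = Wt (x, y) 0 + (\<Sum>k. Wt (x, y) (Suc k))"
    unfolding W_n_def using suminf_split_head[OF summable_W_term[OF X(1)]] by simp
  \<comment> \<open>\<open>F (x, y)\<close> and \<open>F (x, z)\<close> have the same first
    coordinate \<open>Phi \<phi> x\<close>, so the reference orbit of
    \<open>(Phi \<phi> x, z)\<close> cancels in the difference.\<close>
  moreover have "Wt (x, y) (Suc k) = Wt (F (x, y)) k - Wt (F (x, z)) k" for k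
    by (simp add: W_term_def funpow_swap1) (simp add: Phi_n_def)
  moreover have "(\<Sum>k. Wt (F (x, y)) k - Wt (F (x, z)) k) = W (F (x, y)) - W (F (x, z))"
    unfolding W_n_def using X by (intro suminf_diff[symmetric] summable_W_term)
  moreover have "Wt (x, y) 0 = A (x, y) - A (x, z)" by (simp add: W_term_def)
  ultimately show ?thesis by (simp add: B_def)
qed

lemma B_diff_le:
  assumes "x \<in> Omega r" "x' \<in> Omega r" "agree N x x'"
  shows "\<bar>B x - B x'\<bar> \<le> (K + 2 * K / (1 - \<theta>) + Lw / sqrt \<theta>) * sqrt \<theta> ^ N"
proof -
  define s where "s = sqrt \<theta>"
  have s: "0 < s" "s < 1" and s2: "\<theta> = s ^ 2" using theta by (auto simp: s_def)
  have "\<bar>A (x, z) - A (x', z)\<bar> \<le> K * \<theta> ^ N"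
    using assms z by (intro A_diff_le) auto
  moreover have "\<theta> ^ N \<le> s ^ N"
    using s unfolding s2 power_mult[symmetric] by (intro power_decreasing) auto
  then have "K * \<theta> ^ N \<le> K * s ^ N" using K by (rule mult_left_mono)
  moreover have "\<bar>W (F (x, z)) - W (F (x', z))\<bar> \<le> (2 * K / (1 - \<theta>) + Lw / s) * s ^ N"
  proof (cases N)
    \<comment> \<open>The first symbols may differ here, so different inverse branches may act on
      \<open>z\<close> and \<open>W_diff_le\<close> is out of reach; the uniform bound suffices
      since \<open>s ^ 0 = 1\<close>.\<close>
    case 0
    have "F (x, z) \<in> X" "F (x', z) \<in> X" using assms z by (auto intro!: Phi_n_in)
    then have "\<bar>W (F (x, z)) - W (F (x', z))\<bar> \<le> 2 * K / (1 - \<theta>)"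
      using W_le[of "F (x, z)"] W_le[of "F (x', z)"] by linarith
    moreover have "0 \<le> Lw / s" using Lw_nonneg s by simp
    ultimately show ?thesis using 0 by simp
  next
    case (Suc M)
    \<comment> \<open>A common first symbol makes both second coordinates equal to
      \<open>tau r \<phi> (x 0) z\<close>. \<open>Phi\<close> shortens the common prefix by one
      symbol, whence the factor \<open>1 / s\<close>.\<close>
    have x0: "x' 0 = x 0" "x 0 \<in> {1..r}" using assms Suc by (auto simp: agree_def Omega_def)
    have "\<bar>W (Phi \<phi> x, tau r \<phi> (x 0) z) - W (Phi \<phi> x', tau r \<phi> (x 0) z)\<bar> \<le> Lw * sqrt \<theta> ^ M"
      using assms Suc x0 z tau_props[OF x0(2) z] by (intro W_diff_le Phi_Omega agree_Phi) auto
    also have "\<dots> = Lw / s * s ^ N" using s by (simp add: Suc s_def)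
    also have "\<dots> \<le> (2 * K / (1 - \<theta>) + Lw / s) * s ^ N"
      using s K theta by (intro mult_right_mono) auto
    finally show ?thesis using x0 by (simp add: Phi_n_def)
  qed
  ultimately have "\<bar>B x - B x'\<bar> \<le> K * s ^ N + (2 * K / (1 - \<theta>) + Lw / s) * s ^ N"
    by (simp add: B_def)
  then show ?thesis by (simp add: s_def algebra_simps)
qed

lemma lipschitz_B: "lipschitz_wrt (d_seq (sqrt \<theta>)) (Omega r) B"
proof -
  define C where "C = K + 2 * K / (1 - \<theta>) + Lw / sqrt \<theta>"
  have C: "0 \<le> C" using K theta Lw_nonneg by (simp add: C_def)
  have "\<bar>B x - B x'\<bar> \<le> C / sqrt \<theta> * d_seq (sqrt \<theta>) x x'"
    if "x \<in> Omega r" "x' \<in> Omega r" for x x'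
  proof (cases "x = x'")
    case False
    \<comment> \<open>With \<open>N\<close> common symbols the distance is
      \<open>sqrt \<theta> ^ Suc N\<close>; the extra factor is why the Lipschitz constant is
      \<open>C / sqrt \<theta>\<close>.\<close>
    then obtain N where "agree N x x'" "d_seq (sqrt \<theta>) x x' = sqrt \<theta> ^ Suc N"
      by (rule d_seq_eq)
    then show ?thesis using B_diff_le[OF that, of N] theta by (simp add: C_def)
  qed (simp add: d_seq_def)
  then show ?thesis
    unfolding lipschitz_wrt_def using C theta by (intro exI[of _ "C / sqrt \<theta>"]) auto
qed

section \<open>Integrals against invariant probabilities\<close>

lemma continuous_on_A: "continuous_on X A"
  unfolding continuous_on_def
proof (rule ballI, rule tendstoI)
  fix p and e :: real assume p: "p \<in> X" and e: "0 < e"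
  \<comment> \<open>Coordinates are continuous into the discrete space \<open>nat\<close>, so each
    is eventually constant near \<open>p\<close>. Finitely many of them then give a common prefix of
    length \<open>N\<close>.\<close>
  have coord: "eventually (\<lambda>q. fst q i = fst p i \<and> snd q i = snd p i) (at p within X)" for i
  proof -
    have c: "continuous_on UNIV (\<lambda>x::nat \<Rightarrow> nat. x i)" by (rule continuous_on_product_coordinates)
    have "((\<lambda>q. q) \<longlongrightarrow> p) (at p within X)" by (rule tendsto_ident_at)
    then have "((\<lambda>q. fst q i) \<longlongrightarrow> fst p i) (at p within X)"
      and "((\<lambda>q. snd q i) \<longlongrightarrow> snd p i) (at p within X)"
      by (auto intro!: continuous_on_tendsto_compose[OF c] tendsto_fst tendsto_snd)
    then show ?thesis by (simp add: tendsto_discrete eventually_conj)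
  qed
  have "(\<lambda>N. K * \<theta> ^ N) \<longlonglongrightarrow> K * 0"
    using theta by (intro tendsto_mult tendsto_const LIMSEQ_power_zero) auto
  then have "eventually (\<lambda>N. K * \<theta> ^ N < e) sequentially"
    using e by (intro order_tendstoD(2)) auto
  then obtain N where N: "K * \<theta> ^ N < e" by (auto simp: eventually_sequentially)
  have "eventually (\<lambda>q. \<forall>i\<in>{..<N}. fst q i = fst p i \<and> snd q i = snd p i) (at p within X)"
    by (intro eventually_ball_finite) (auto intro: coord)
  moreover have "eventually (\<lambda>q. q \<in> X) (at p within X)" 
    by (auto simp: eventually_at_topological intro!: exI[of _ UNIV])
  ultimately show "eventually (\<lambda>q. dist (A q) (A p) < e) (at p within X)"
  proof eventually_elim
    case (elim q)
    then have "\<bar>A q - A p\<bar> \<le> K * \<theta> ^ N"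
      using p by (intro A_diff_le) (auto simp: agree_def)
    then show ?case using N by (simp add: dist_real_def)
  qed
qed

text \<open>Invariance cancels the integrals of \<open>W\<close> and \<open>W \<circ> F\<close>.
  This requires integrability, obtained from measurability and the uniform bound on
  \<open>W\<close>.\<close>

lemma integral_A_eq_B:
  assumes "\<mu> \<in> invariant_probs X F"
  shows "(\<integral>p. A p \<partial>\<mu>) = (\<integral>p. (case p of (x, y) \<Rightarrow> B x) \<partial>\<mu>)"
proof -
  have pr: "prob_space \<mu>" and sets: "sets \<mu> = sets (restrict_space borel X)"
    and F: "F \<in> measurable \<mu> \<mu>" and inv: "distr \<mu> \<mu> F = \<mu>"
    using assms by (auto simp: invariant_probs_def)
  interpret prob_space \<mu> by (rule pr)
  have space: "space \<mu> = X" using sets_eq_imp_space_eq[OF sets] by (simp add: space_restrict_space)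
  have A: "A \<in> borel_measurable \<mu>"
    unfolding measurable_cong_sets[OF sets refl]
    by (rule borel_measurable_continuous_on_restrict[OF continuous_on_A])
  \<comment> \<open>The reference orbit starts at a continuous function of \<open>p\<close> mapping
    \<open>X\<close> into itself, which makes every term of the series measurable.\<close>
  have "(\<lambda>p::(nat \<Rightarrow> nat) \<times> (nat \<Rightarrow> nat). (fst p, z)) \<in> borel_measurable borel"
    by (intro borel_measurable_continuous_onI continuous_intros)
  then have proj: "(\<lambda>p. (fst p, z)) \<in> measurable \<mu> \<mu>"
    unfolding measurable_cong_sets[OF sets sets] using z
    by (intro measurable_restrict_space3) auto
  have Fk: "(F ^^ k) \<in> measurable \<mu> \<mu>" for k by (rule measurable_compose_n[OF F])
  have Wt_eq: "Wt p k = A ((F ^^ k) p) - A ((F ^^ k) (fst p, z))" for p k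
    by (simp add: W_term_def split: prod.split)
  have W: "W \<in> borel_measurable \<mu>"
    unfolding W_n_def Wt_eq
    by (intro borel_measurable_suminf borel_measurable_diff measurable_compose[OF Fk A]
        measurable_compose[OF measurable_compose[OF proj Fk] A])
  have iW: "integrable \<mu> W"
    by (rule integrable_const_bound[where B = "K / (1 - \<theta>)"])
      (use W W_le space in \<open>auto intro!: AE_I2\<close>)
  have iWF: "integrable \<mu> (\<lambda>p. W (F p))"
    by (rule integrable_const_bound[where B = "K / (1 - \<theta>)"])
      (use measurable_compose[OF F W] W_le[OF Phi_n_in] space in \<open>auto intro!: AE_I2\<close>)
  \<comment> \<open>Prefix length 0 gives the crude oscillation bound
    \<open>K * \<theta> ^ 0 = K\<close>.\<close>
  have "\<bar>A p\<bar> \<le> \<bar>A (z, z)\<bar> + K" if "p \<in> X" for p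
    using A_diff_le[of p "(z, z)" 0] that z by auto
  then have iA: "integrable \<mu> A"
    using A space by (intro integrable_const_bound[where B = "\<bar>A (z, z)\<bar> + K"] AE_I2) auto
  have "(\<integral>p. (case p of (x, y) \<Rightarrow> B x) \<partial>\<mu>) = (\<integral>p. A p - W p + W (F p) \<partial>\<mu>)"
    by (rule Bochner_Integration.integral_cong) (auto simp: space cohomology)
  also have "\<dots> = (\<integral>p. A p \<partial>\<mu>) - (\<integral>p. W p \<partial>\<mu>) + (\<integral>p. W (F p) \<partial>\<mu>)"
    using iA iW iWF by simp
  also have "(\<integral>p. W (F p) \<partial>\<mu>) = (\<integral>p. W p \<partial>\<mu>)"
    using integral_distr[OF F W] by (simp add: inv)
  finally show ?thesis by simp
qed

end

text \<open>The entropy term does not involve the potential, so both variational functionals agree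
  on all invariant probabilities; for any other \<open>\<mu>\<close> both sides are false.\<close>

lemma equilibrium_prob_cong:
  assumes "\<And>\<nu>. \<nu> \<in> invariant_probs X T \<Longrightarrow> (\<integral>p. C p \<partial>\<nu>) = (\<integral>p. D p \<partial>\<nu>)"
  shows "equilibrium_prob X T C \<mu> \<longleftrightarrow> equilibrium_prob X T D \<mu>"
proof -
  have "(SUP \<nu>\<in>invariant_probs X T. KS_entropy \<nu> T + ereal (\<integral>p. C p \<partial>\<nu>)) =
      (SUP \<nu>\<in>invariant_probs X T. KS_entropy \<nu> T + ereal (\<integral>p. D p \<partial>\<nu>))"
    by (rule SUP_cong) (simp_all add: assms)
  then show ?thesis using assms[of \<mu>] by (auto simp: equilibrium_prob_def)
qed

theorem mainTheorem4:
  fixes r :: nat and \<phi> :: "nat \<Rightarrow> nat \<Rightarrow> nat" and \<theta> :: real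
    and A :: "(nat \<Rightarrow> nat) \<times> (nat \<Rightarrow> nat) \<Rightarrow> real" and z :: "nat \<Rightarrow> nat"
  assumes "\<forall>a\<in>{1..r}. bij_betw (\<phi> a) {1..r} {1..r}"
    and "0 < \<theta>" and "\<theta> < 1"
    and "lipschitz_wrt (d_hat \<theta>) (Omega r \<times> Omega r) A"
    and "z \<in> Omega r"
  shows "(\<forall>x\<in>Omega r. \<forall>y\<in>Omega r. summable (W_term r \<phi> A z (x, y))) \<and>
    (\<exists>B :: (nat \<Rightarrow> nat) \<Rightarrow> real.
       lipschitz_wrt (d_seq (sqrt \<theta>)) (Omega r) B \<and>
       (\<forall>x\<in>Omega r. \<forall>y\<in>Omega r.
          A (x, y) = B x + W_n r \<phi> A z (x, y) - W_n r \<phi> A z (Phi_n r \<phi> (x, y))) \<and>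
       (\<forall>\<mu>. equilibrium_prob (Omega r \<times> Omega r) (Phi_n r \<phi>) A \<mu> \<longleftrightarrow>
            equilibrium_prob (Omega r \<times> Omega r) (Phi_n r \<phi>) (\<lambda>(x, y). B x) \<mu>))"
proof -
  obtain K where "0 \<le> K"
    and "\<forall>p\<in>Omega r \<times> Omega r. \<forall>q\<in>Omega r \<times> Omega r. \<bar>A p - A q\<bar> \<le> K * d_hat \<theta> p q"
    using assms(4) unfolding lipschitz_wrt_def by blast
  then interpret lipschitz_potential r \<phi> \<theta> K A z
    using assms by unfold_locales blast+
  show ?thesis
    using summable_W_term lipschitz_B cohomology equilibrium_prob_cong[OF integral_A_eq_B]
    by (intro conjI exI[of _ B] ballI allI) auto
qed

end
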